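(* If $T$ is a regular tournament with $\gamma(T)\geq 4$, then $T$ is out-quadrangular.
   Context: A tournament is a loopless digraph in which for each pair of distinct vertices exactly one of $(u,v)$, $(v,u)$ is an arc; it is regular if all vertices have equal out-degree. $O(v)$ is the set of vertices $v$ beats. A digraph is out-quadrangular if $|O(u)\cap O(v)|\neq 1$ for all distinct vertices $u,v$. A dominating set of $T$ is a set $S$ of vertices such that every vertex is in $S$ or dominated by some vertex of $S$; $\gamma(T)$ is the minimum size of a dominating set. *)

theory Defs
  imports "Graph_Theory.Digraph"
begin

text \<open>The library locale \<open>digraph\<close> provides finiteness and excludes loops and parallel arcs.\<close>

locale tournament = digraph T for T :: "('a, 'b) pre_digraph" (structure) +
  assumes exactly_one_arc:
    "\<lbrakk>u \<in> verts T; v \<in> verts T; u \<noteq> v\<rbrakk> \<Longrightarrow> (u \<rightarrow>\<^bsub>T\<^esub> v) \<longleftrightarrow> \<not> (v \<rightarrow>\<^bsub>T\<^esub> u)"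

locale regular_tournament = tournament +
  assumes equal_out_degrees:
    "\<lbrakk>u \<in> verts T; v \<in> verts T\<rbrakk> \<Longrightarrow> out_degree T u = out_degree T v"

definition out_set :: "('a, 'b) pre_digraph \<Rightarrow> 'a \<Rightarrow> 'a set" where
  "out_set G v = {w \<in> verts G. v \<rightarrow>\<^bsub>G\<^esub> w}"

definition out_quadrangular :: "('a, 'b) pre_digraph \<Rightarrow> bool" where
  "out_quadrangular G \<longleftrightarrow>
     (\<forall>u \<in> verts G. \<forall>v \<in> verts G. u \<noteq> v \<longrightarrow> card (out_set G u \<inter> out_set G v) \<noteq> 1)"

definition dominating_set :: "('a, 'b) pre_digraph \<Rightarrow> 'a set \<Rightarrow> bool" where
  "dominating_set G S \<longleftrightarrow>
     S \<subseteq> verts G \<and> (\<forall>v \<in> verts G. v \<in> S \<or> (\<exists>u \<in> S. u \<rightarrow>\<^bsub>G\<^esub> v))"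

text \<open>
  Intended for finite digraphs, where the whole vertex set witnesses that the minimum exists.
\<close>

definition domination_number :: "('a, 'b) pre_digraph \<Rightarrow> nat" where
  "domination_number G = (LEAST k. \<exists>S. dominating_set G S \<and> card S = k)"

end

theory Submission
  imports Defs
begin

text \<open>
  A regular tournament with out-degree \<open>k\<close> has \<open>2k + 1\<close> vertices. If \<open>u\<close> beats \<open>v\<close> and
  \<open>O(u) \<inter> O(v)\<close> is a singleton, then \<open>{u} \<union> O(u) \<union> O(v)\<close> contains \<open>v\<close> and has \<open>2k\<close> elements, so
  \<open>u\<close>, \<open>v\<close> and the single vertex left over form a dominating set.
\<close>

text \<open>Regularity is stated by counting arcs, domination by counting vertices; without parallel
  arcs, \<open>head G\<close> matches the two bijectively.\<close>

lemma (in digraph) card_out_set: "card (out_set G v) = out_degree G v"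
proof -
  have "out_set G v = head G ` out_arcs G v"
    by (auto simp: out_set_def out_arcs_def arcs_ends_def arc_to_ends_def)
  moreover have "inj_on (head G) (out_arcs G v)"
    using no_multi_arcs by (auto simp: inj_on_def out_arcs_def arc_to_ends_def)
  ultimately show ?thesis
    by (simp add: card_image out_degree_def)
qed

lemma (in digraph) domination_number_le:
  assumes "dominating_set G S"
  shows "domination_number G \<le> card S"
  unfolding domination_number_def by (rule Least_le) (use assms in blast)

lemma (in digraph) finite_out_set: "finite (out_set G v)"
  by (simp add: out_set_def)

text \<open>A vertex, those it beats and those that beat it partition the tournament.\<close>

lemma (in tournament) card_out_set_plus_in_set:
  assumes "v \<in> verts T"
  shows "card (out_set T v) + card {u \<in> verts T. u \<rightarrow>\<^bsub>T\<^esub> v} + 1 = card (verts T)"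
proof -
  let ?I = "{u \<in> verts T. u \<rightarrow>\<^bsub>T\<^esub> v}"
  have irrefl: "\<not> v \<rightarrow>\<^bsub>T\<^esub> v"
    using adj_not_same by blast
  have "verts T = insert v (out_set T v \<union> ?I)"
    using assms exactly_one_arc by (auto simp: out_set_def)
  moreover have "out_set T v \<inter> ?I = {}"
  proof -
    have False if "w \<in> out_set T v" "w \<in> ?I" for w
      using that assms exactly_one_arc[of v w] irrefl by (cases "w = v") (auto simp: out_set_def)
    then show ?thesis
      by blast
  qed
  moreover have "v \<notin> out_set T v \<union> ?I"
    using irrefl by (simp add: out_set_def)
  ultimately show ?thesis
    using card_Un_disjoint[of "out_set T v" ?I]
      card_insert_disjoint[of "out_set T v \<union> ?I" v] finite_out_set[of v] finite_verts
    by (simp del: insert_iff Un_iff)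
qed

text \<open>Equal out-degrees force equal in-degrees. Counting the arcs by tail and by head then
  shows that the two common values agree.\<close>

lemma (in regular_tournament) card_verts_eq:
  assumes "v \<in> verts T"
  shows "card (verts T) = 2 * card (out_set T v) + 1"
proof -
  let ?V = "verts T" and ?k = "card (out_set T v)"
  have out: "card (out_set T w) = ?k" if "w \<in> ?V" for w
    using equal_out_degrees[OF that assms] by (simp add: card_out_set)
  have "(\<Sum>w\<in>?V. card {u \<in> ?V. u \<rightarrow>\<^bsub>T\<^esub> w}) = ?k * card ?V"
    by (rule sum_multicount) (use out in \<open>auto simp: out_set_def\<close>)
  moreover have "card {u \<in> ?V. u \<rightarrow>\<^bsub>T\<^esub> w} = card ?V - 1 - ?k" if "w \<in> ?V" for w
    using card_out_set_plus_in_set[OF that] out[OF that] by simp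
  ultimately have "card ?V * (card ?V - 1 - ?k) = ?k * card ?V"
    by simp
  \<comment> \<open>The vertex \<open>v\<close> makes \<open>card ?V\<close> nonzero, so this factor
    cancels.\<close>
  then have "card ?V - 1 - ?k = ?k"
    using assms by auto
  with card_out_set_plus_in_set[OF assms] show ?thesis
    by simp
qed

lemma (in regular_tournament) domination_number_le_3:
  assumes u: "u \<in> verts T" and v: "v \<in> verts T" and uv: "u \<rightarrow>\<^bsub>T\<^esub> v"
    and common: "card (out_set T u \<inter> out_set T v) = 1"
  shows "domination_number T \<le> 3"
proof -
  let ?D = "insert u (out_set T u \<union> out_set T v)"
  let ?k = "card (out_set T u)"
  have "u \<noteq> v"
    using uv adj_not_same by blast
  then have "\<not> v \<rightarrow>\<^bsub>T\<^esub> u"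
    using exactly_one_arc u v uv by blast
  moreover have "\<not> u \<rightarrow>\<^bsub>T\<^esub> u"
    using adj_not_same by blast
  ultimately have "u \<notin> out_set T u \<union> out_set T v"
    by (simp add: out_set_def)
  then have "card ?D = Suc (card (out_set T u \<union> out_set T v))"
    by (simp add: finite_out_set)
  moreover have "card (out_set T v) = ?k"
    using card_verts_eq[OF u] card_verts_eq[OF v] by simp
  \<comment> \<open>The union of the two out-sets has \<open>2 * ?k - 1\<close> elements by
    inclusion-exclusion, and \<open>u\<close> supplies one more.\<close>
  ultimately have "card ?D = 2 * ?k"
    using card_Un_Int[OF finite_out_set finite_out_set, of u v] common by simp
  moreover have "?D \<subseteq> verts T"
    using u by (auto simp: out_set_def)
  ultimately have "card (verts T - ?D) = 1"
    using card_verts_eq[OF u] by (simp add: card_Diff_subset finite_out_set)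
  then obtain x where x: "verts T - ?D = {x}"
    by (auto simp: card_1_singleton_iff)
  \<comment> \<open>A vertex of \<open>?D\<close> is \<open>u\<close> itself or is beaten by
    \<open>u\<close> or \<open>v\<close>; outside \<open>?D\<close> there is only
    \<open>x\<close>.\<close>
  have "dominating_set T {u, v, x}"
    using x u v by (auto simp: dominating_set_def out_set_def)
  then have "domination_number T \<le> card {u, v, x}"
    by (rule domination_number_le)
  also have "\<dots> \<le> 3"
    by (simp add: card_insert_if)
  finally show ?thesis .
qed

theorem theorem16:
  fixes T :: "('a, 'b) pre_digraph"
  assumes "regular_tournament T"
    and "domination_number T \<ge> 4"
  shows "out_quadrangular T"
  unfolding out_quadrangular_def
proof (intro ballI impI notI)
  interpret regular_tournament T by fact
  fix u v
  assume u: "u \<in> verts T" and v: "v \<in> verts T" and "u \<noteq> v"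
    and common: "card (out_set T u \<inter> out_set T v) = 1"
  then consider "u \<rightarrow>\<^bsub>T\<^esub> v" | "v \<rightarrow>\<^bsub>T\<^esub> u"
    using exactly_one_arc by blast
  \<comment> \<open>The hypothesis \<open>common\<close> is symmetric in \<open>u\<close> and
    \<open>v\<close>, so the direction of the arc between them is immaterial.\<close>
  then have "domination_number T \<le> 3"
    using domination_number_le_3[OF u v _ common] domination_number_le_3[OF v u] common
    by cases (auto simp: Int_commute)
  with assms(2) show False
    by simp
qed

end
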